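(* Let $\eta_0$ be the first hitting time of $\overline{\rho}$ by the walk $W$ on the random tree $\overline{\mathcal{T}}$ started from $\rho$. If $\beta\mu<1$, $\sigma^2<\infty$ and $\beta\ge1$, then $$\mathbb{E}[\eta_0]=\frac{\mu(\beta+1)(1-\beta\mu)+2\beta(\sigma^2-\mu(1-\mu))}{\mu(\beta+1)(1-\beta\mu)}.$$ Moreover, if $\sigma^2=\infty$ or $\beta\ge\mu^{-1}$ then $\mathbb{E}[\eta_0]=\infty$.
   Context: Let $\xi$ be an offspring random variable with $\mathbf{P}(\xi=k)=p_k$, mean $\mu\in(0,1)$ and variance $\sigma^2$, such that $p_k>0$ for some $k\ge2$; let $f$ be its generating function. Let $\xi^*$ have the size-biased law $\mathbf{P}(\xi^*=k)=kp_k/\mu$. The random tree $\overline{\mathcal{T}}$ is built as follows: take a vertex $\rho$ with a unique ancestor (parent) $\overline{\rho}$; attach $\xi^*-1$ children to $\rho$; to each such child attach an independent $f$-Galton-Watson tree rooted at that child. Let $c(x)$ be the set of children of $x$ and $\overleftarrow{x}$ its parent. Given $\overline{\mathcal{T}}$, $(W_n)_{n\ge0}$ is the Markov chain absorbed at $\overline{\rho}$ with transition probabilities: from $\rho$, to $\overline{\rho}$ with probability $\frac{\beta+1}{\beta(|c(\rho)|+1)+1}$ and to each $y\in c(\rho)$ with probability $\frac{\beta}{\beta(|c(\rho)|+1)+1}$; from $x\notin\{\rho,\overline{\rho}\}$, to each $y\in c(x)$ with probability $\frac{\beta}{|c(x)|\beta+1}$ and to $\overleftarrow{x}$ with probability $\frac{1}{|c(x)|\beta+1}$.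 $\mathbb{E}$ denotes the annealed expectation (averaging over both $\overline{\mathcal{T}}$ and $W$). Throughout $\beta\ge1$. *)

theory Defs
  imports "HOL-Probability.Probability"
begin

section \<open>Offspring distribution\<close>

text \<open>
  The Bochner integral is 0 when \<^term>\<open>real\<close> is not integrable, so \<open>0 < offspring_mean p\<close>
  forces the mean to be finite.
\<close>

definition offspring_mean :: "nat pmf \<Rightarrow> real" where
  "offspring_mean p = measure_pmf.expectation p real"

definition offspring_variance :: "nat pmf \<Rightarrow> ennreal" where
  "offspring_variance p = (\<integral>\<^sup>+k. ennreal ((real k - offspring_mean p)\<^sup>2) \<partial>measure_pmf p)"

definition size_biased :: "nat pmf \<Rightarrow> nat pmf" where
  "size_biased p = embed_pmf (\<lambda>k. real k * pmf p k / offspring_mean p)"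

lemma integrable_offspring:
  "0 < offspring_mean p \<Longrightarrow> integrable (measure_pmf p) real"
  unfolding offspring_mean_def using not_integrable_integral_eq by fastforce

lemma pmf_size_biased:
  assumes "0 < offspring_mean p"
  shows "pmf (size_biased p) k = real k * pmf p k / offspring_mean p"
  unfolding size_biased_def
proof (rule pmf_embed_pmf)
  show "0 \<le> real k * pmf p k / offspring_mean p" for k
    using assms by simp
  have "(\<integral>\<^sup>+k. ennreal (real k * pmf p k / offspring_mean p) \<partial>count_space UNIV)
      = (\<integral>\<^sup>+k. ennreal (real k / offspring_mean p) \<partial>measure_pmf p)"
    unfolding nn_integral_measure_pmf using assms
    by (intro nn_integral_cong) (simp add: ennreal_mult[symmetric] field_simps)
  also have "\<dots> = ennreal (\<integral>k. real k / offspring_mean p \<partial>measure_pmf p)"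
    using assms integrable_offspring[OF assms]
    by (intro nn_integral_eq_integral) auto
  also have "(\<integral>k. real k / offspring_mean p \<partial>measure_pmf p) = 1"
    using assms by (simp add: offspring_mean_def)
  finally show "(\<integral>\<^sup>+k. ennreal (real k * pmf p k / offspring_mean p) \<partial>count_space UNIV) = 1"
    by simp
qed

section \<open>The random tree\<close>

text \<open>
  Ulam--Harris labelling: \<open>V []\<close> is \<open>\<rho>\<close>, \<open>V (u @ [i])\<close> is the \<open>i\<close>-th child of \<open>V u\<close>, counted from 0,
  and \<open>Anc\<close> is the parent of \<open>\<rho>\<close>. A tree is given by its offspring counts \<open>T :: nat list \<Rightarrow> nat\<close>:
  \<open>\<rho>\<close> belongs to it, and \<open>V (u @ [i])\<close> belongs to it iff \<open>V u\<close> does and \<open>i < T u\<close>. The values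
  of \<open>T\<close> at labels outside the tree play no role, since the walk never leaves the tree.
\<close>

datatype vertex = Anc | V "nat list"

instance vertex :: countable
  by countable_datatype

definition children :: "(nat list \<Rightarrow> nat) \<Rightarrow> nat list \<Rightarrow> vertex set" where
  "children T u = (\<lambda>i. V (u @ [i])) ` {..<T u}"

definition parent :: "nat list \<Rightarrow> vertex" where
  "parent u = (if u = [] then Anc else V (butlast u))"

lemma card_children [simp]: "card (children T u) = T u"
  unfolding children_def by (subst card_image) (auto simp: inj_on_def)

lemma finite_children [simp]: "finite (children T u)"
  by (simp add: children_def)

lemma parent_notin_children [simp]: "parent u \<notin> children T u"
  by (cases u rule: rev_cases) (auto simp: parent_def children_def)

text \<open>
  The offspring counts are independent; \<open>\<rho>\<close> has \<open>\<xi>\<^sup>* - 1\<close> children. As \<open>\<xi>\<^sup>* \<ge> 1\<close> almost surely,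
  the truncated subtraction is the actual one.
\<close>

definition tree_law :: "nat pmf \<Rightarrow> (nat list \<Rightarrow> nat) measure" where
  "tree_law p = (\<Pi>\<^sub>M u\<in>UNIV. measure_pmf
     (if u = [] then map_pmf (\<lambda>k. k - 1) (size_biased p) else p))"

lemma prob_space_tree_law: "prob_space (tree_law p)"
  unfolding tree_law_def by (intro prob_space_PiM prob_space_measure_pmf)

section \<open>Markov chains on a discrete state space\<close>

definition markov_step :: "('a \<Rightarrow> 'a pmf) \<Rightarrow> 'a \<Rightarrow> nat \<Rightarrow> (nat \<Rightarrow> 'a) \<Rightarrow> 'a measure" where
  "markov_step K x n w =
     measure_pmf (case n of 0 \<Rightarrow> return_pmf x | Suc m \<Rightarrow> K (w m))"

text \<open>The law on path space of the Markov chain with kernel \<open>K\<close> started from \<open>x\<close>, obtained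
  from the Ionescu-Tulcea extension theorem.\<close>

definition markov_law :: "('a \<Rightarrow> 'a pmf) \<Rightarrow> 'a \<Rightarrow> (nat \<Rightarrow> 'a) measure" where
  "markov_law K x = projective_family.lim UNIV
     (Ionescu_Tulcea.CI (markov_step K x) (\<lambda>_. count_space UNIV)) (\<lambda>_. count_space UNIV)"

lemma Ionescu_Tulcea_markov_step:
  "Ionescu_Tulcea (markov_step K x) (\<lambda>_. count_space UNIV)"
proof (rule Ionescu_Tulcea.intro)
  fix n
  show "markov_step K x n \<in> PiM {0..<n} (\<lambda>_. count_space UNIV)
      \<rightarrow>\<^sub>M subprob_algebra (count_space UNIV)"
  proof (cases n)
    case 0
    then show ?thesis
      by (auto simp: markov_step_def[abs_def] space_subprob_algebra
               intro!: measurable_const prob_space_imp_subprob_space prob_space_measure_pmf)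
  next
    case (Suc m)
    have "(\<lambda>y. measure_pmf (K y)) \<in> count_space UNIV \<rightarrow>\<^sub>M subprob_algebra (count_space UNIV)"
      by (auto simp: space_subprob_algebra
               intro!: prob_space_imp_subprob_space prob_space_measure_pmf)
    moreover have "(\<lambda>w. w m) \<in> PiM {0..<n} (\<lambda>_. count_space UNIV) \<rightarrow>\<^sub>M count_space UNIV"
      using Suc by (intro measurable_component_singleton) auto
    ultimately show ?thesis
      unfolding Suc markov_step_def[abs_def] by (auto dest: measurable_compose)
  qed
qed (simp add: markov_step_def prob_space_measure_pmf)

lemma sets_markov_law [simp, measurable_cong]:
  "sets (markov_law K x) = sets (PiM UNIV (\<lambda>_. count_space UNIV))"
proof -
  interpret Ionescu_Tulcea "markov_step K x" "\<lambda>_. count_space UNIV"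
    by (rule Ionescu_Tulcea_markov_step)
  show ?thesis
    by (simp add: markov_law_def)
qed

lemma emeasure_markov_law_cylinder:
  "emeasure (markov_law K x) {w. \<forall>i\<le>n. w i = a i} =
     ennreal (of_bool (a 0 = x) * (\<Prod>i<n. pmf (K (a i)) (a (Suc i))))"
proof -
  interpret Ionescu_Tulcea "markov_step K x" "\<lambda>_. count_space UNIV"
    by (rule Ionescu_Tulcea_markov_step)
  let ?M = "\<lambda>_::nat. count_space (UNIV :: 'a set)"
  let ?S = "\<lambda>n. {restrict a {0..<n}}"
  have S: "?S n = (\<Pi>\<^sub>E i\<in>{0..<n}. {a i})" for n
  proof -
    have "(\<Pi>\<^sub>E i\<in>{0..<n}. {a i}) = (\<Pi>\<^sub>E i\<in>{0..<n}. {restrict a {0..<n} i})"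
      by (rule PiE_cong) simp
    also have "\<dots> = ?S n"
      by (rule PiE_singleton) (rule restrict_extensional)
    finally show ?thesis ..
  qed
  have S_sets [measurable]: "?S n \<in> sets (PiM {0..<n} ?M)" for n
    unfolding S by (intro sets_PiM_I_finite) auto
  have eP: "emeasure (eP n w) (?S (Suc n)) =
      emeasure (markov_step K x n a) {a n} * indicator (?S n) w"
    if w: "w \<in> space (PiM {0..<n} ?M)" for n w
  proof -
    have ext: "w \<in> extensional {0..<n}"
      using w by (simp add: space_PiM PiE_def)
    have "(\<lambda>y. w(n := y)) -` ?S (Suc n) = (if w \<in> ?S n then {a n} else {})"
    proof -
      have eq: "w(n := y) = restrict a {0..<Suc n} \<longleftrightarrow> w = restrict a {0..<n} \<and> y = a n" for y
      proof (intro iffI conjI)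
        assume eq: "w(n := y) = restrict a {0..<Suc n}"
        from fun_cong[OF eq, of n] show "y = a n" by simp
        show "w = restrict a {0..<n}"
        proof
          fix i
          show "w i = restrict a {0..<n} i"
            using fun_cong[OF eq, of i] ext
            by (cases "i < n") (auto simp: extensional_def)
        qed
      qed (auto simp: fun_eq_iff)
      show ?thesis
        by (rule set_eqI)
           (simp only: vimage_singleton_eq eq singleton_iff if_distrib[of "(\<in>) _"] empty_iff split: if_split, blast)
    qed
    moreover have "markov_step K x n (restrict a {0..<n}) = markov_step K x n a"
      by (auto simp: markov_step_def split: nat.split)
    ultimately show ?thesis
      using w by (subst emeasure_eP) (auto simp: indicator_def)
  qed
  have C: "emeasure (C 0 (Suc n) (\<lambda>_. undefined)) (?S (Suc n)) =
      ennreal (of_bool (a 0 = x) * (\<Prod>i<n. pmf (K (a i)) (a (Suc i))))" for n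
  proof -
    have step: "emeasure (C 0 (Suc n) (\<lambda>_. undefined)) (?S (Suc n)) =
        emeasure (markov_step K x n a) {a n} * emeasure (C 0 n (\<lambda>_. undefined)) (?S n)" for n
    proof -
      have sp: "space (C 0 n (\<lambda>_. undefined)) = space (PiM {0..<n} ?M)"
        using space_C[of "\<lambda>_. undefined" 0 n] by (simp add: space_PiM)
      have st: "sets (C 0 n (\<lambda>_. undefined)) = sets (PiM {0..<n} ?M)"
        using sets_C[of "\<lambda>_. undefined" 0 n] by (simp add: space_PiM)
      have "emeasure (C 0 (Suc n) (\<lambda>_. undefined)) (?S (Suc n)) =
          (\<integral>\<^sup>+w. emeasure (eP n w) (?S (Suc n)) \<partial>C 0 n (\<lambda>_. undefined))"
        using measurable_eP[of n] S_sets[of "Suc n"]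
        by (simp, subst emeasure_bind[where N="PiM {0..<Suc n} ?M"])
           (auto simp: sp measurable_cong_sets[OF st refl])
      also have "\<dots> = (\<integral>\<^sup>+w. emeasure (markov_step K x n a) {a n} * indicator (?S n) w
          \<partial>C 0 n (\<lambda>_. undefined))"
        by (intro nn_integral_cong eP) (simp add: sp)
      also have "\<dots> = emeasure (markov_step K x n a) {a n} * emeasure (C 0 n (\<lambda>_. undefined)) (?S n)"
        using S_sets[of n] by (intro nn_integral_cmult_indicator) (simp add: st)
      finally show ?thesis .
    qed
    show ?thesis
    proof (induction n)
      case 0
      have "emeasure (C 0 0 (\<lambda>_. undefined)) (?S 0) = 1"
        using S_sets[of 0] by (simp add: restrict_def)
      then show ?case
        unfolding step[of 0] by (simp add: markov_step_def indicator_def)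
    next
      case (Suc n)
      show ?case
        unfolding step[of "Suc n"] Suc.IH
        by (simp add: markov_step_def emeasure_pmf_single ennreal_mult[symmetric] prod_nonneg mult.commute mult.left_commute)
    qed
  qed
  have "restrict w A = restrict a A \<longleftrightarrow> (\<forall>i\<in>A. w i = a i)" for w and A :: "nat set"
    by (metis restrict_apply' restrict_ext)
  then have "{w. \<forall>i\<le>n. w i = a i} = PF.emb UNIV {0..<Suc n} (?S (Suc n))"
    by (auto simp: prod_emb_def space_PiM)
  then have "emeasure (markov_law K x) {w. \<forall>i\<le>n. w i = a i} = emeasure (CI {0..<Suc n}) (?S (Suc n))"
    unfolding markov_law_def using S_sets[of "Suc n"] by (simp add: lim)
  also have "\<dots> = emeasure (C 0 (Suc n) (\<lambda>_. undefined)) (PF.emb {0..<Suc n} {0..<Suc n} (?S (Suc n)))"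
    using S_sets[of "Suc n"] by (intro emeasure_CI) auto
  also have "PF.emb {0..<Suc n} {0..<Suc n} (?S (Suc n)) = ?S (Suc n)"
    using S_sets[of "Suc n"] by (intro prod_emb_id) (auto dest: sets.sets_into_space simp: space_PiM)
  finally show ?thesis
    unfolding C .
qed

lemma prob_space_markov_law: "prob_space (markov_law K x)"
proof -
  interpret Ionescu_Tulcea "markov_step K x" "\<lambda>_. count_space UNIV"
    by (rule Ionescu_Tulcea_markov_step)
  have "prob_space (CI {})"
    by (intro PF.prob_space_P) auto
  then have "prob_space (distr PF.lim (PiM {} (\<lambda>_. count_space UNIV)) (\<lambda>w. restrict w {}))"
    by (subst distr_lim) auto
  moreover have "(\<lambda>w. restrict w {}) \<in> PF.lim \<rightarrow>\<^sub>M PiM {} (\<lambda>_. count_space UNIV)"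
    by (auto intro!: measurable_restrict)
  ultimately show ?thesis
    unfolding markov_law_def by (rule prob_space_distrD[rotated])
qed

section \<open>The biased walk on the tree\<close>

definition transition_prob :: "real \<Rightarrow> (nat list \<Rightarrow> nat) \<Rightarrow> vertex \<Rightarrow> vertex \<Rightarrow> real" where
  "transition_prob \<beta> T x y = (case x of
       Anc \<Rightarrow> of_bool (y = Anc)
     | V u \<Rightarrow>
         let d = real (card (children T u)) in
         if u = [] then
           (if y = Anc then (\<beta> + 1) / (\<beta> * (d + 1) + 1)
            else if y \<in> children T u then \<beta> / (\<beta> * (d + 1) + 1)
            else 0)
         else
           (if y = parent u then 1 / (d * \<beta> + 1)
            else if y \<in> children T u then \<beta> / (d * \<beta> + 1)
            else 0))"

definition walk_kernel :: "real \<Rightarrow> (nat list \<Rightarrow> nat) \<Rightarrow> vertex \<Rightarrow> vertex pmf" where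
  "walk_kernel \<beta> T x = embed_pmf (transition_prob \<beta> T x)"

lemma pmf_walk_kernel:
  assumes "0 \<le> \<beta>"
  shows "pmf (walk_kernel \<beta> T x) y = transition_prob \<beta> T x y"
  unfolding walk_kernel_def
proof (rule pmf_embed_pmf)
  show nonneg: "0 \<le> transition_prob \<beta> T x y" for y
    using assms by (auto simp: transition_prob_def Let_def split: vertex.split)
  show "(\<integral>\<^sup>+y. ennreal (transition_prob \<beta> T x y) \<partial>count_space UNIV) = 1"
  proof (cases x)
    case Anc
    have "(\<integral>\<^sup>+y. ennreal (transition_prob \<beta> T x y) \<partial>count_space UNIV) =
        (\<Sum>y\<in>{Anc}. ennreal (transition_prob \<beta> T x y))"
      by (intro nn_integral_count_space') (auto simp: Anc transition_prob_def)
    then show ?thesis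
      by (simp add: Anc transition_prob_def)
  next
    case (V u)
    define d where "d = real (T u)"
    have d: "0 \<le> d" "0 \<le> \<beta> * d" using assms by (auto simp: d_def)
    have "(\<integral>\<^sup>+y. ennreal (transition_prob \<beta> T x y) \<partial>count_space UNIV) =
        (\<Sum>y\<in>insert (parent u) (children T u). ennreal (transition_prob \<beta> T x y))"
      by (intro nn_integral_count_space')
         (auto simp: V transition_prob_def Let_def parent_def split: if_splits)
    also have "\<dots> = ennreal (\<Sum>y\<in>insert (parent u) (children T u). transition_prob \<beta> T x y)"
      by (intro sum_ennreal nonneg)
    also have "(\<Sum>y\<in>insert (parent u) (children T u). transition_prob \<beta> T x y) =
        transition_prob \<beta> T x (parent u) + (\<Sum>y\<in>children T u. transition_prob \<beta> T x y)"
      by simp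
    also have "(\<Sum>y\<in>children T u. transition_prob \<beta> T x y) =
        (\<Sum>y\<in>children T u. if u = [] then \<beta> / (\<beta> * (d + 1) + 1) else \<beta> / (d * \<beta> + 1))"
      using parent_notin_children[of u T]
      by (intro sum.cong) (auto simp: V transition_prob_def Let_def d_def parent_def)
    also have "\<dots> = d * (if u = [] then \<beta> / (\<beta> * (d + 1) + 1) else \<beta> / (d * \<beta> + 1))"
      by (simp add: d_def)
    also have "transition_prob \<beta> T x (parent u) + \<dots> = 1"
    proof (cases "u = []")
      case True
      have "\<beta> * (d + 1) + 1 > 0"
        using d assms by (intro add_nonneg_pos mult_nonneg_nonneg) auto
      moreover have "transition_prob \<beta> T x (parent u) = (\<beta> + 1) / (\<beta> * (d + 1) + 1)"
        using True by (simp add: V transition_prob_def parent_def d_def)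
      ultimately show ?thesis
        using True by (simp add: field_simps)
    next
      case False
      have "d * \<beta> + 1 > 0"
        using d by (simp add: mult.commute add_nonneg_pos)
      moreover have "transition_prob \<beta> T x (parent u) = 1 / (d * \<beta> + 1)"
        using False by (simp add: V transition_prob_def d_def)
      ultimately show ?thesis
        using False by (simp add: field_simps)
    qed
    finally show ?thesis by simp
  qed
qed

definition walk_law :: "real \<Rightarrow> (nat list \<Rightarrow> nat) \<Rightarrow> (nat \<Rightarrow> vertex) measure" where
  "walk_law \<beta> T = markov_law (walk_kernel \<beta> T) (V [])"

definition hitting_time :: "'a \<Rightarrow> (nat \<Rightarrow> 'a) \<Rightarrow> enat" where
  "hitting_time x w = Inf {enat n | n. w n = x}"

text \<open>First average over the walk given the tree, then over the tree.\<close>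

definition annealed_expectation :: "nat pmf \<Rightarrow> real \<Rightarrow> ((nat \<Rightarrow> vertex) \<Rightarrow> ennreal) \<Rightarrow> ennreal" where
  "annealed_expectation p \<beta> F = (\<integral>\<^sup>+T. (\<integral>\<^sup>+w. F w \<partial>walk_law \<beta> T) \<partial>tree_law p)"

end

theory Submission
  imports Defs
begin

text \<open>
  Given the tree, the walk is a reversible nearest-neighbour walk: the edge between \<open>\<rho>\<close> and
  \<open>\<rho>\<close>'s parent has conductance \<open>\<beta> + 1\<close>, and an edge ending in generation \<open>n \<ge> 1\<close> has
  conductance \<open>\<beta> ^ n\<close>. Let \<open>e u\<close> be the mean time that the walk needs to step from \<open>u\<close> to the
  parent of \<open>u\<close> for the first time. On a finite tree it visits each child of \<open>u\<close> \<open>\<beta> / c u\<close> times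
  on average before that, where \<open>c \<rho> = \<beta> + 1\<close> and \<open>c u = 1\<close> otherwise, and each visit
  costs one step to the child and the time to return from it. So

    \<open>e u = 1 + \<beta> / c u * (\<Sum>i < T u. 1 + e (child i of u))\<close>.

  On an infinite tree this system may have many solutions. The right one is the least one, the
  supremum over \<open>k\<close> of the iterates \<open>excursion \<beta> T k\<close> started from 0
  (\<open>quenched_expected_hitting_time\<close>). This is proved for every tree, with both sides possibly
  infinite, by comparing the walk with the functions \<open>V u \<mapsto> sum of e\<close> over \<open>u\<close> and its
  ancestors: the least solution gives a function that decreases in the mean by
  at least 1 per step, which bounds the hitting time from above; an iterate cut off outside the
  tree gives a bounded function that decreases by at most 1 per step, which bounds it from below.

  Averaging over the tree turns the recursion into a scalar one, because \<open>T u\<close> is independent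
  of the offspring counts further down. Away from \<open>\<rho>\<close> the mean \<open>m\<close> of the iterates obeys
  \<open>m \<mapsto> 1 + \<beta> * \<mu> * (1 + m)\<close>, whose iterates from 0 tend to a limit with
  \<open>1 + m = 2 / (1 - \<beta> * \<mu>)\<close> if \<open>\<beta> * \<mu> < 1\<close>, and to infinity otherwise. At \<open>\<rho>\<close> one more step of
  the recursion gives

    \<open>1 + \<beta> / (\<beta> + 1) * D * (1 + m)\<close>,

  where \<open>D\<close> is the mean of \<open>\<xi>\<^sup>* - 1\<close>, equal to the mean of \<open>\<xi> * (\<xi> - 1)\<close> divided by \<open>\<mu>\<close>, that is
  \<open>(\<sigma>\<^sup>2 - \<mu> * (1 - \<mu>)) / \<mu>\<close>. This is positive since \<open>\<xi> \<ge> 2\<close> has positive probability, and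
  infinite iff \<open>\<sigma>\<^sup>2\<close> is. So both the formula and the divergence can be read off.
\<close>

section \<open>Hitting times of Markov chains on a countable state space\<close>

primrec state_law :: "('a \<Rightarrow> 'a pmf) \<Rightarrow> 'a \<Rightarrow> nat \<Rightarrow> 'a pmf" where
  "state_law K x 0 = return_pmf x"
| "state_law K x (Suc n) = bind_pmf (state_law K x n) K"

lemma measurable_markov_coordinate [measurable]:
  "(\<lambda>w. w n) \<in> markov_law K x \<rightarrow>\<^sub>M count_space UNIV"
  by (subst measurable_cong_sets[OF sets_markov_law refl]) (rule measurable_component_singleton, simp)

lemma space_markov_law [simp]: "space (markov_law K x) = UNIV"
  using sets_eq_imp_space_eq[OF sets_markov_law[of K x]] by (simp add: space_PiM)

lemma coordinate_events [simp]:
  fixes y z :: 'a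
  shows "{w. w n = y} \<in> sets (PiM UNIV (\<lambda>_::nat. count_space UNIV))"
    and "{w. w n = y \<and> w m = z} \<in> sets (PiM UNIV (\<lambda>_::nat. count_space UNIV))"
proof -
  let ?P = "PiM UNIV (\<lambda>_::nat. count_space (UNIV :: 'a set))"
  have "{w \<in> space ?P. w n = y} \<in> sets ?P" for n y
    by measurable
  then show event: "{w. w n = y} \<in> sets ?P" for n y
    by (simp add: space_PiM)
  show "{w. w n = y \<and> w m = z} \<in> sets ?P"
    unfolding Collect_conj_eq by (intro sets.Int event)
qed

text \<open>
  The Markov property for one step: decompose the event according to the whole path up to time
  \<open>n\<close>, of which there are countably many, and use the product formula for each path.
\<close>
lemma emeasure_markov_law_two_step:
  fixes K :: "'a::countable \<Rightarrow> 'a pmf"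
  shows "emeasure (markov_law K x) {w. w n = y \<and> w (Suc n) = z} =
    emeasure (markov_law K x) {w. w n = y} * ennreal (pmf (K y) z)"
proof -
  let ?M = "markov_law K x"
  define L where "L = {l :: 'a list. length l = Suc n \<and> l ! n = y}"
  \<comment> \<open>the paths with initial segment \<open>l\<close>, and those among them that go on to \<open>z\<close>\<close>
  define C where "C l = {w. \<forall>i\<le>n. w i = l ! i}" for l :: "'a list"
  define D where "D l = {w. \<forall>i\<le>Suc n. w i = (l @ [z]) ! i}" for l :: "'a list"
  have path: "map w [0..<Suc n] \<in> L \<and> w \<in> C (map w [0..<Suc n])" if "w n = y" for w
    using that by (auto simp: L_def C_def nth_append simp del: upt_Suc)
  have C: "{w. w n = y} = (\<Union>l\<in>L. C l)"
  proof (intro equalityI subsetI)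
    show "w \<in> (\<Union>l\<in>L. C l)" if "w \<in> {w. w n = y}" for w
      using path[of w] that by blast
  qed (auto simp: L_def C_def)
  have D_eq: "D l = C l \<inter> {w. w (Suc n) = z}" if "l \<in> L" for l
    using that by (auto simp: D_def C_def L_def nth_append le_Suc_eq)
  then have D: "{w. w n = y \<and> w (Suc n) = z} = (\<Union>l\<in>L. D l)"
    using C by blast
  have disj: "l = l'" if "l \<in> L" "l' \<in> L" "w \<in> C l" "w \<in> C l'" for l l' w
    using that by (intro nth_equalityI) (auto simp: L_def C_def less_Suc_eq_le)
  have C_sets [simp]: "C l \<in> sets (PiM UNIV (\<lambda>_. count_space UNIV))" for l
  proof -
    have "C l = (\<Inter>i\<in>{..n}. {w. w i = l ! i})"
      by (auto simp: C_def)
    also have "\<dots> \<in> sets (PiM UNIV (\<lambda>_. count_space UNIV))"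
      by (intro sets.finite_INT) auto
    finally show ?thesis .
  qed
  have D_sets [simp]: "D l \<in> sets (PiM UNIV (\<lambda>_. count_space UNIV))" if "l \<in> L" for l
    unfolding D_eq[OF that] by (intro sets.Int) simp_all
  have D_measure: "emeasure ?M (D l) = emeasure ?M (C l) * ennreal (pmf (K y) z)" if "l \<in> L" for l
  proof -
    have "(\<Prod>i<n. pmf (K ((l @ [z]) ! i)) ((l @ [z]) ! Suc i)) = (\<Prod>i<n. pmf (K (l ! i)) (l ! Suc i))"
      using that by (intro prod.cong) (auto simp: L_def nth_append)
    then show ?thesis
      using that unfolding C_def D_def emeasure_markov_law_cylinder
      by (simp add: L_def nth_append ennreal_mult prod_nonneg flip: mult.assoc)
  qed
  have cnt: "countable L" by (rule countableI_type)
  have "emeasure ?M {w. w n = y \<and> w (Suc n) = z} = (\<integral>\<^sup>+l. emeasure ?M (D l) \<partial>count_space L)"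
    unfolding D using disj D_eq cnt
    by (intro emeasure_UN_countable) (auto simp: disjoint_family_on_def)
  also have "\<dots> = (\<integral>\<^sup>+l. emeasure ?M (C l) * ennreal (pmf (K y) z) \<partial>count_space L)"
    by (intro nn_integral_cong) (simp add: D_measure)
  also have "\<dots> = (\<integral>\<^sup>+l. emeasure ?M (C l) \<partial>count_space L) * ennreal (pmf (K y) z)"
    by (simp add: nn_integral_multc)
  also have "(\<integral>\<^sup>+l. emeasure ?M (C l) \<partial>count_space L) = emeasure ?M {w. w n = y}"
    unfolding C using disj cnt
    by (intro emeasure_UN_countable[symmetric]) (auto simp: disjoint_family_on_def)
  finally show ?thesis .
qed

lemma emeasure_markov_law_state:
  fixes K :: "'a::countable \<Rightarrow> 'a pmf"
  shows "emeasure (markov_law K x) {w. w n = y} = ennreal (pmf (state_law K x n) y)"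
proof (induction n arbitrary: y)
  case 0
  show ?case
    using emeasure_markov_law_cylinder[of K x 0 "\<lambda>_. y"] by (auto simp: pmf_return indicator_def)
next
  case (Suc n)
  have "{w. w (Suc n) = y} = (\<Union>z. {w. w n = z \<and> w (Suc n) = y})"
    by auto
  also have "emeasure (markov_law K x) \<dots> =
      (\<integral>\<^sup>+z. emeasure (markov_law K x) {w. w n = z \<and> w (Suc n) = y} \<partial>count_space UNIV)"
    by (intro emeasure_UN_countable) (auto simp: disjoint_family_on_def)
  also have "\<dots> = (\<integral>\<^sup>+z. ennreal (pmf (state_law K x n) z) * ennreal (pmf (K z) y) \<partial>count_space UNIV)"
    by (simp add: emeasure_markov_law_two_step Suc.IH)
  also have "\<dots> = ennreal (pmf (state_law K x (Suc n)) y)"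
    by (simp add: ennreal_pmf_bind nn_integral_measure_pmf)
  finally show ?case .
qed

text \<open>
  The law on path space does not exclude paths that leave the absorbing state, but they form a
  null set. Hence, almost surely, \<open>a\<close> has been hit by time \<open>n\<close> iff the chain is at \<open>a\<close> at time \<open>n\<close>.
\<close>
lemma AE_markov_law_absorbed:
  fixes K :: "'a::countable \<Rightarrow> 'a pmf"
  assumes "K a = return_pmf a"
  shows "AE w in markov_law K x. \<forall>n. w n = a \<longrightarrow> w (Suc n) = a"
proof -
  have "AE w in markov_law K x. \<forall>z. z \<noteq> a \<longrightarrow> \<not> (w n = a \<and> w (Suc n) = z)" for n
  proof (subst AE_all_countable, intro allI AE_impI)
    fix z assume "z \<noteq> a"
    then have "emeasure (markov_law K x) {w. w n = a \<and> w (Suc n) = z} = 0"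
      unfolding emeasure_markov_law_two_step by (simp add: assms)
    then show "AE w in markov_law K x. \<not> (w n = a \<and> w (Suc n) = z)"
      by (intro AE_I[of _ _ "{w. w n = a \<and> w (Suc n) = z}"]) auto
  qed
  then have "AE w in markov_law K x. w n = a \<longrightarrow> w (Suc n) = a" for n
    by (rule AE_mp) auto
  then show ?thesis
    by (simp add: AE_all_countable)
qed

lemma less_hitting_time_iff: "enat n < hitting_time a w \<longleftrightarrow> (\<forall>i\<le>n. w i \<noteq> a)"
proof
  assume less: "enat n < hitting_time a w"
  show "\<forall>i\<le>n. w i \<noteq> a"
  proof (intro allI impI notI)
    fix i assume "i \<le> n" "w i = a"
    then have "hitting_time a w \<le> enat i"
      unfolding hitting_time_def by (intro Inf_lower) auto
    also have "\<dots> \<le> enat n" using \<open>i \<le> n\<close> by simp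
    finally show False using less by simp
  qed
next
  assume "\<forall>i\<le>n. w i \<noteq> a"
  then have "enat (Suc n) \<le> hitting_time a w"
    unfolding hitting_time_def by (intro Inf_greatest) (auto simp: not_less_eq_eq[symmetric])
  then show "enat n < hitting_time a w"
    by (rule less_le_trans[rotated]) simp
qed

lemma hitting_time_eq_Least:
  "hitting_time a w = (if \<exists>n. w n = a then enat (LEAST n. w n = a) else \<infinity>)"
proof (cases "\<exists>n. w n = a")
  case True
  then have "w (LEAST n. w n = a) = a"
    by (rule LeastI_ex)
  then have "hitting_time a w \<le> enat (LEAST n. w n = a)"
    unfolding hitting_time_def by (intro Inf_lower) blast
  moreover have "enat (LEAST n. w n = a) \<le> hitting_time a w"
    unfolding hitting_time_def by (intro Inf_greatest) (auto intro: Least_le)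
  ultimately show ?thesis
    using True by simp
qed (simp add: hitting_time_def top_enat_def)

lemma measurable_hitting_time [measurable]:
  "hitting_time a \<in> markov_law K x \<rightarrow>\<^sub>M count_space UNIV"
  unfolding hitting_time_eq_Least[abs_def] by measurable

text \<open>
  Tail-sum formula. It reduces statements about the path space to the one-dimensional laws
  \<open>state_law\<close>, for which integrals of \<open>h\<close> can be propagated one step at a time.
\<close>
lemma expectation_hitting_time:
  fixes K :: "'a::countable \<Rightarrow> 'a pmf"
  assumes "K a = return_pmf a"
  shows "(\<integral>\<^sup>+w. ennreal_of_enat (hitting_time a w) \<partial>markov_law K x) =
    (\<Sum>n. emeasure (state_law K x n) (-{a}))"
proof -
  have "emeasure (markov_law K x) {w \<in> space (markov_law K x). enat n < hitting_time a w} =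
      emeasure (state_law K x n) (-{a})" for n
  proof -
    have "AE w in markov_law K x. enat n < hitting_time a w \<longleftrightarrow> w n \<noteq> a"
      using AE_markov_law_absorbed[of K a x, OF assms]
    proof (eventually_elim)
      fix w assume abs: "\<forall>n. w n = a \<longrightarrow> w (Suc n) = a"
      have "w n = a" if "i \<le> n" "w i = a" for i
        using that by (induction rule: dec_induct) (use abs in auto)
      then show "enat n < hitting_time a w \<longleftrightarrow> w n \<noteq> a"
        unfolding less_hitting_time_iff by auto
    qed
    then have "emeasure (markov_law K x) {w \<in> space (markov_law K x). enat n < hitting_time a w} =
        emeasure (markov_law K x) {w \<in> space (markov_law K x). w n \<noteq> a}"
    proof (intro emeasure_eq_AE)
      show "{w \<in> space (markov_law K x). enat n < hitting_time a w} \<in> sets (markov_law K x)"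
        by measurable
      show "{w \<in> space (markov_law K x). w n \<noteq> a} \<in> sets (markov_law K x)"
        by measurable
    qed auto
    also have "\<dots> = emeasure (markov_law K x) (\<Union>y\<in>-{a}. {w. w n = y})"
      by (intro arg_cong[where f = "emeasure _"]) auto
    also have "\<dots> = (\<integral>\<^sup>+y. emeasure (markov_law K x) {w. w n = y} \<partial>count_space (-{a}))"
      by (intro emeasure_UN_countable) (auto simp: disjoint_family_on_def)
    also have "\<dots> = emeasure (state_law K x n) (-{a})"
      by (simp add: emeasure_markov_law_state nn_integral_pmf)
    finally show ?thesis .
  qed
  then show ?thesis
    by (simp add: nn_integral_enat_function)
qed

text \<open>
  The hypothesis says that \<open>h\<close> drops by at least 1 in the mean in each step before absorption.
  Summed over the first \<open>n\<close> steps, the expected drop is at most \<open>h x\<close>, because \<open>h \<ge> 0\<close>.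
\<close>
lemma expectation_hitting_time_le:
  fixes K :: "'a::countable \<Rightarrow> 'a pmf" and h :: "'a \<Rightarrow> ennreal"
  assumes absorbed: "K a = return_pmf a"
    and super: "\<And>y. y \<noteq> a \<Longrightarrow> 1 + (\<integral>\<^sup>+z. h z \<partial>K y) \<le> h y"
  shows "(\<integral>\<^sup>+w. ennreal_of_enat (hitting_time a w) \<partial>markov_law K x) \<le> h x"
proof -
  have super': "indicator (-{a}) y + (\<integral>\<^sup>+z. h z \<partial>K y) \<le> h y" for y
    using super[of y] by (cases "y = a") (auto simp: absorbed)
  have "(\<Sum>k<n. emeasure (state_law K x k) (-{a})) + (\<integral>\<^sup>+y. h y \<partial>state_law K x n) \<le> h x" for n
  proof (induction n)
    case (Suc n)
    have "emeasure (state_law K x n) (-{a}) + (\<integral>\<^sup>+y. h y \<partial>state_law K x (Suc n)) =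
        (\<integral>\<^sup>+y. indicator (-{a}) y + (\<integral>\<^sup>+z. h z \<partial>K y) \<partial>state_law K x n)"
      by (simp add: nn_integral_add)
    also have "\<dots> \<le> (\<integral>\<^sup>+y. h y \<partial>state_law K x n)"
      by (intro nn_integral_mono super')
    finally show ?case
      using Suc.IH by (simp add: add.assoc del: state_law.simps) (meson add_left_mono order_trans)
  qed simp
  then show ?thesis
    unfolding expectation_hitting_time[of K a x, OF absorbed]
    by (intro suminf_le_const summableI) (meson add_increasing2 order_refl order_trans zero_le)
qed

text \<open>
  If \<open>h\<close> drops by at most 1 in the mean in each step, then \<open>h x\<close> is at most the expected time
  before \<open>n\<close> spent outside \<open>a\<close> plus the mean of \<open>h\<close> at time \<open>n\<close>. Boundedness of \<open>h\<close> and \<open>h a = 0\<close>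
  control the latter by a multiple of the probability of not being absorbed, which tends to 0 if
  the expected hitting time is finite.
\<close>
lemma le_expectation_hitting_time:
  fixes K :: "'a::countable \<Rightarrow> 'a pmf" and h :: "'a \<Rightarrow> ennreal"
  assumes absorbed: "K a = return_pmf a"
    and sub: "\<And>y. y \<noteq> a \<Longrightarrow> h y \<le> 1 + (\<integral>\<^sup>+z. h z \<partial>K y)"
    and bounded: "h a = 0" "\<And>y. h y \<le> B" "B < \<infinity>"
  shows "h x \<le> (\<integral>\<^sup>+w. ennreal_of_enat (hitting_time a w) \<partial>markov_law K x)"
proof -
  define q where "q n = emeasure (state_law K x n) (-{a})" for n
  have sub': "h y \<le> indicator (-{a}) y + (\<integral>\<^sup>+z. h z \<partial>K y)" for y
    using sub[of y] bounded(1) by (cases "y = a") auto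
  have h_le: "h x \<le> (\<Sum>k<n. q k) + (\<integral>\<^sup>+y. h y \<partial>state_law K x n)" for n
  proof (induction n)
    case (Suc n)
    have "(\<integral>\<^sup>+y. h y \<partial>state_law K x n) \<le>
        (\<integral>\<^sup>+y. indicator (-{a}) y + (\<integral>\<^sup>+z. h z \<partial>K y) \<partial>state_law K x n)"
      by (intro nn_integral_mono sub')
    also have "\<dots> = q n + (\<integral>\<^sup>+y. h y \<partial>state_law K x (Suc n))"
      by (simp add: nn_integral_add q_def)
    finally show ?case
      using Suc.IH by (simp add: add.assoc del: state_law.simps) (meson add_left_mono order_trans)
  qed simp
  have "(\<integral>\<^sup>+y. h y \<partial>state_law K x n) \<le> B * q n" for n
  proof -
    have "(\<integral>\<^sup>+y. h y \<partial>state_law K x n) \<le> (\<integral>\<^sup>+y. B * indicator (-{a}) y \<partial>state_law K x n)"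
      using bounded by (intro nn_integral_mono) (auto simp: indicator_def)
    then show ?thesis by (simp add: nn_integral_cmult q_def)
  qed
  then have h_le_q: "h x \<le> suminf q + B * q n" for n
    using h_le[of n] by (meson add_mono order_trans sum_le_suminf[OF summableI finite_lessThan] zero_le)
  show ?thesis
  proof (cases "suminf q = \<infinity>")
    case False
    define r where "r n = measure (state_law K x n) (-{a})" for n
    have q: "q = (\<lambda>n. ennreal (r n))"
      by (simp add: q_def r_def measure_pmf.emeasure_eq_measure fun_eq_iff)
    have "summable r"
      using False by (intro summable_suminf_not_top) (auto simp: q r_def)
    then have "q \<longlonglongrightarrow> ennreal 0"
      unfolding q by (intro tendsto_ennrealI summable_LIMSEQ_zero)
    then have "q \<longlonglongrightarrow> 0" by simp
    then have "(\<lambda>n. suminf q + B * q n) \<longlonglongrightarrow> suminf q + B * 0"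
      using bounded by (intro tendsto_add tendsto_const ennreal_tendsto_cmult) auto
    then have "h x \<le> suminf q"
      using h_le_q by (intro LIMSEQ_le_const[of _ "suminf q"]) auto
    then show ?thesis
      unfolding expectation_hitting_time[of K a x, OF absorbed] q_def .
  qed (simp add: expectation_hitting_time[of K a x, OF absorbed] flip: q_def)
qed

section \<open>The walk on a fixed tree\<close>

text \<open>
  The transition probabilities from \<open>V u\<close> are proportional to weight \<open>\<beta>\<close> for each child and
  \<open>parent_weight \<beta> u\<close> for the parent, with the same form at \<open>\<rho>\<close> as elsewhere.
\<close>
definition parent_weight :: "real \<Rightarrow> nat list \<Rightarrow> real" where
  "parent_weight \<beta> u = (if u = [] then \<beta> + 1 else 1)"

definition total_weight :: "real \<Rightarrow> (nat list \<Rightarrow> nat) \<Rightarrow> nat list \<Rightarrow> real" where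
  "total_weight \<beta> T u = \<beta> * real (T u) + parent_weight \<beta> u"

lemma weight_pos:
  assumes "0 \<le> \<beta>"
  shows "0 < parent_weight \<beta> u" "0 < total_weight \<beta> T u"
  using assms by (auto simp: parent_weight_def total_weight_def add_nonneg_pos)

lemma step_probabilities_sum:
  assumes "0 \<le> \<beta>"
  shows "ennreal (parent_weight \<beta> u / total_weight \<beta> T u) +
    ennreal (\<beta> / total_weight \<beta> T u) * of_nat (T u) = 1"
proof -
  let ?c = "parent_weight \<beta> u" and ?s = "total_weight \<beta> T u"
  note pos = weight_pos(1)[OF assms, of u] weight_pos(2)[OF assms, of T u]
  have "ennreal (?c / ?s) + ennreal (\<beta> / ?s) * of_nat (T u) = ennreal (?c / ?s + \<beta> / ?s * real (T u))"
    using assms pos by (simp add: ennreal_of_nat_eq_real_of_nat flip: ennreal_mult ennreal_plus)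
  also have "?c / ?s + \<beta> / ?s * real (T u) = (\<beta> * real (T u) + ?c) / ?s"
    by (simp add: add_divide_distrib)
  also have "\<dots> = 1"
    using pos by (simp flip: total_weight_def)
  finally show ?thesis by simp
qed

lemma nn_integral_walk_kernel:
  fixes h :: "vertex \<Rightarrow> ennreal"
  assumes "0 \<le> \<beta>"
  shows "(\<integral>\<^sup>+y. h y \<partial>walk_kernel \<beta> T (V u)) =
    ennreal (parent_weight \<beta> u / total_weight \<beta> T u) * h (parent u) +
    ennreal (\<beta> / total_weight \<beta> T u) * (\<Sum>i<T u. h (V (u @ [i])))"
proof -
  have "set_pmf (walk_kernel \<beta> T (V u)) \<subseteq> insert (parent u) (children T u)"
    using assms by (auto simp: set_pmf_iff pmf_walk_kernel transition_prob_def Let_def parent_def split: if_splits)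
  then have "(\<integral>\<^sup>+y. h y \<partial>walk_kernel \<beta> T (V u)) =
      (\<Sum>y\<in>insert (parent u) (children T u). h y * ennreal (pmf (walk_kernel \<beta> T (V u)) y))"
    by (intro nn_integral_measure_pmf_support) auto
  also have "\<dots> = h (parent u) * ennreal (pmf (walk_kernel \<beta> T (V u)) (parent u)) +
      (\<Sum>y\<in>children T u. h y * ennreal (pmf (walk_kernel \<beta> T (V u)) y))"
    by simp
  also have "(\<Sum>y\<in>children T u. h y * ennreal (pmf (walk_kernel \<beta> T (V u)) y)) =
      (\<Sum>y\<in>children T u. h y * ennreal (\<beta> / total_weight \<beta> T u))"
    using assms parent_notin_children[of u T]
    by (intro sum.cong)
       (auto simp: pmf_walk_kernel transition_prob_def Let_def parent_def total_weight_def parent_weight_def algebra_simps)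
  also have "\<dots> = (\<Sum>i<T u. h (V (u @ [i])) * ennreal (\<beta> / total_weight \<beta> T u))"
    unfolding children_def by (subst sum.reindex) (auto simp: inj_on_def)
  also have "\<dots> = ennreal (\<beta> / total_weight \<beta> T u) * (\<Sum>i<T u. h (V (u @ [i])))"
    by (simp add: sum_distrib_left mult.commute)
  also have "pmf (walk_kernel \<beta> T (V u)) (parent u) = parent_weight \<beta> u / total_weight \<beta> T u"
    using assms by (auto simp: pmf_walk_kernel transition_prob_def Let_def parent_def total_weight_def parent_weight_def algebra_simps)
  finally show ?thesis by (simp add: mult.commute)
qed

lemma walk_kernel_Anc:
  assumes "0 \<le> \<beta>"
  shows "walk_kernel \<beta> T Anc = return_pmf Anc"
  using assms by (intro pmf_eqI) (auto simp: pmf_walk_kernel transition_prob_def pmf_return indicator_def)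

text \<open>
  To reach \<open>Anc\<close>, the walk has to make the step to the parent from each ancestor in turn. So if
  \<open>e v\<close> is the mean time to go from \<open>v\<close> to the parent of \<open>v\<close>, the mean time to reach \<open>Anc\<close> from \<open>u\<close> is the
  sum of \<open>e\<close> over \<open>u\<close> and its ancestors.
\<close>
primrec ancestral_sum :: "(nat list \<Rightarrow> ennreal) \<Rightarrow> vertex \<Rightarrow> ennreal" where
  "ancestral_sum e Anc = 0"
| "ancestral_sum e (V u) = (\<Sum>j\<le>length u. e (take j u))"

lemma ancestral_sum_child: "ancestral_sum e (V (u @ [i])) = ancestral_sum e (V u) + e (u @ [i])"
  by simp

lemma ancestral_sum_parent: "ancestral_sum e (V u) = ancestral_sum e (parent u) + e u"
  by (cases u rule: rev_cases) (auto simp: parent_def)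

declare ancestral_sum.simps(2) [simp del]

lemma nn_integral_ancestral_sum:
  assumes "0 \<le> \<beta>"
  shows "(\<integral>\<^sup>+y. ancestral_sum e y \<partial>walk_kernel \<beta> T (V u)) =
    ancestral_sum e (parent u) + ennreal (\<beta> / total_weight \<beta> T u) *
      (of_nat (T u) * e u + (\<Sum>i<T u. e (u @ [i])))"
proof -
  let ?c = "parent_weight \<beta> u" and ?s = "total_weight \<beta> T u" and ?a = "ancestral_sum e (parent u)"
  have "(\<integral>\<^sup>+y. ancestral_sum e y \<partial>walk_kernel \<beta> T (V u)) =
      ennreal (?c / ?s) * ?a + ennreal (\<beta> / ?s) * (\<Sum>i<T u. ?a + e u + e (u @ [i]))"
    using assms by (simp add: nn_integral_walk_kernel ancestral_sum_child ancestral_sum_parent[of e u])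
  also have "\<dots> = (ennreal (?c / ?s) + ennreal (\<beta> / ?s) * of_nat (T u)) * ?a +
      ennreal (\<beta> / ?s) * (of_nat (T u) * e u + (\<Sum>i<T u. e (u @ [i])))"
    by (simp add: sum.distrib algebra_simps)
  finally show ?thesis
    by (simp add: step_probabilities_sum[OF assms])
qed

text \<open>
  Multiplying the recursion for \<open>e u\<close> by the probability \<open>c / s\<close> of stepping to the parent turns it
  into the equation of first-step analysis. The computation adds the term
  \<open>\<beta> / s * T u * e u\<close> to both sides and never subtracts, so that it is valid for infinite values.
\<close>
lemma first_step_equation:
  assumes "0 \<le> \<beta>"
    and e: "e u = 1 + ennreal (\<beta> / parent_weight \<beta> u) * (\<Sum>i<T u. 1 + e (u @ [i]))"
  shows "1 + (\<integral>\<^sup>+y. ancestral_sum e y \<partial>walk_kernel \<beta> T (V u)) = ancestral_sum e (V u)"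
proof -
  define c where "c = parent_weight \<beta> u"
  define s where "s = total_weight \<beta> T u"
  define S where "S = (\<Sum>i<T u. e (u @ [i]))"
  have c: "c > 0" and s: "s > 0"
    using weight_pos[OF assms(1)] by (simp_all add: c_def s_def)
  have total: "ennreal (c / s) + ennreal (\<beta> / s) * of_nat (T u) = 1"
    unfolding c_def s_def by (rule step_probabilities_sum[OF assms(1)])
  have "c / s * (\<beta> / c) = \<beta> / s" using c by simp
  then have ratio: "ennreal (c / s) * ennreal (\<beta> / c) = ennreal (\<beta> / s)"
    using assms c s by (simp flip: ennreal_mult)
  have "ennreal (c / s) * e u = ennreal (c / s) + ennreal (\<beta> / s) * (of_nat (T u) + S)"
    unfolding e by (simp add: sum.distrib distrib_left S_def ratio flip: c_def mult.assoc)
  also have "\<dots> = 1 + ennreal (\<beta> / s) * S"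
    by (simp add: distrib_left total flip: add.assoc)
  finally have "ennreal (c / s) * e u + ennreal (\<beta> / s) * of_nat (T u) * e u =
      1 + ennreal (\<beta> / s) * (of_nat (T u) * e u + S)"
    by (simp add: algebra_simps)
  then have "e u = 1 + ennreal (\<beta> / s) * (of_nat (T u) * e u + S)"
    by (simp add: total flip: distrib_right)
  then show ?thesis
    unfolding nn_integral_ancestral_sum[OF assms(1)] ancestral_sum_parent[of e u]
    by (simp add: s_def c_def S_def add_ac)
qed

text \<open>
  The iterates, started from 0, of the recursion satisfied by the mean time to go from \<open>u\<close> to the
  parent of \<open>u\<close>. The \<open>k\<close>-th one depends only on the first \<open>k\<close> generations below \<open>u\<close>.
\<close>
primrec excursion :: "real \<Rightarrow> (nat list \<Rightarrow> nat) \<Rightarrow> nat \<Rightarrow> nat list \<Rightarrow> ennreal" where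
  "excursion \<beta> T 0 u = 0"
| "excursion \<beta> T (Suc k) u =
     1 + ennreal (\<beta> / parent_weight \<beta> u) * (\<Sum>i<T u. 1 + excursion \<beta> T k (u @ [i]))"

lemma excursion_finite: "excursion \<beta> T k u < \<infinity>"
  by (induction k arbitrary: u) (auto simp: ennreal_mult_less_top less_top)

lemma excursion_mono_Suc: "excursion \<beta> T k u \<le> excursion \<beta> T (Suc k) u"
proof (induction k arbitrary: u)
  case (Suc k)
  show ?case
    by (subst (1 2) excursion.simps(2)) (intro add_left_mono mult_left_mono sum_mono Suc.IH, simp)
qed simp

lemma incseq_excursion: "incseq (\<lambda>k. excursion \<beta> T k u)"
  by (intro incseq_SucI excursion_mono_Suc)

lemma SUP_Suc_ennreal:
  fixes f :: "nat \<Rightarrow> ennreal"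
  assumes "incseq f"
  shows "(SUP k. f (Suc k)) = (SUP k. f k)"
  using assms by (intro antisym SUP_mono) (auto simp: incseq_Suc_iff intro: exI)

lemma SUP_excursion:
  "(SUP k. excursion \<beta> T k u) =
    1 + ennreal (\<beta> / parent_weight \<beta> u) * (\<Sum>i<T u. 1 + (SUP k. excursion \<beta> T k (u @ [i])))"
proof -
  have inc: "incseq (\<lambda>k. 1 + excursion \<beta> T k v)" for v
    using incseq_excursion[of \<beta> T v] by (auto simp: incseq_def intro: add_left_mono)
  have "(SUP k. excursion \<beta> T k u) = (SUP k. excursion \<beta> T (Suc k) u)"
    by (rule SUP_Suc_ennreal[symmetric, OF incseq_excursion])
  also have "\<dots> = 1 + ennreal (\<beta> / parent_weight \<beta> u) * (SUP k. \<Sum>i<T u. 1 + excursion \<beta> T k (u @ [i]))"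
    by (simp add: ennreal_SUP_add_right SUP_mult_left_ennreal)
  also have "(SUP k. \<Sum>i<T u. 1 + excursion \<beta> T k (u @ [i])) =
      (\<Sum>i<T u. SUP k. 1 + excursion \<beta> T k (u @ [i]))"
    by (intro ennreal_SUP_sum inc)
  finally show ?thesis
    by (simp add: ennreal_SUP_add_right)
qed

primrec generation :: "(nat list \<Rightarrow> nat) \<Rightarrow> nat \<Rightarrow> nat list set" where
  "generation T 0 = {[]}"
| "generation T (Suc n) = (\<Union>u\<in>generation T n. (\<lambda>i. u @ [i]) ` {..<T u})"

lemma finite_generation: "finite (generation T n)"
  by (induction n) auto

definition tree_labels :: "(nat list \<Rightarrow> nat) \<Rightarrow> nat list set" where
  "tree_labels T = {u. u \<in> generation T (length u)}"

lemma tree_labels_child: "u @ [i] \<in> tree_labels T \<longleftrightarrow> u \<in> tree_labels T \<and> i < T u"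
  by (auto simp: tree_labels_def)

text \<open>
  The comparison function uses the iterate of order \<open>N - n\<close> in generation \<open>n\<close>, so that consecutive
  generations are linked by one step of the recursion, down to generation \<open>N\<close>, from where on
  \<open>e\<close> vanishes and the ancestral sum does not change from parent to child. The values of \<open>T\<close> at
  labels outside the tree are arbitrary and could make the ancestral sum unbounded; setting \<open>e\<close>
  to 0 there leaves finitely many labels with \<open>e \<noteq> 0\<close>.
\<close>
lemma excursion_le_expected_hitting_time:
  assumes "0 \<le> \<beta>"
  shows "excursion \<beta> T N [] \<le> (\<integral>\<^sup>+w. ennreal_of_enat (hitting_time Anc w) \<partial>walk_law \<beta> T)"
proof -
  define e where "e v = (if v \<in> tree_labels T then excursion \<beta> T (N - length v) v else 0)" for v
  define G where "G = (\<Union>n<N. generation T n)"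
  define B where "B = (\<Sum>v\<in>G. excursion \<beta> T (N - length v) v)"
  have G: "finite G" by (auto simp: G_def finite_generation)
  have outside: "e v = 0" if "v \<notin> G" for v
    using that by (cases "length v < N") (auto simp: e_def G_def tree_labels_def)
  have e_le: "e v \<le> excursion \<beta> T (N - length v) v" for v
    by (simp add: e_def)
  have sub: "ancestral_sum e y \<le> 1 + (\<integral>\<^sup>+z. ancestral_sum e z \<partial>walk_kernel \<beta> T y)" if "y \<noteq> Anc" for y
  proof -
    from that obtain u where y: "y = V u" by (cases y) auto
    show ?thesis
    proof (cases "u \<in> tree_labels T \<and> length u < N")
      case True
      then have "e u = 1 + ennreal (\<beta> / parent_weight \<beta> u) * (\<Sum>i<T u. 1 + e (u @ [i]))"
        by (simp add: e_def tree_labels_child Suc_diff_Suc[symmetric])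
      then show ?thesis
        using first_step_equation[OF assms, of e u T] by (simp add: y)
    next
      case False
      then have "e u = 0" by (auto simp: e_def)
      then show ?thesis
        unfolding y nn_integral_ancestral_sum[OF assms] ancestral_sum_parent[of e u]
        by (simp add: add_increasing add_increasing2)
    qed
  qed
  have bound: "ancestral_sum e y \<le> B" for y
  proof (cases y)
    case (V u)
    let ?P = "(\<lambda>j. take j u) ` {..length u}"
    have "inj_on (\<lambda>j. take j u) {..length u}"
      by (auto simp: inj_on_def) (metis length_take min.absorb2)
    then have "ancestral_sum e y = (\<Sum>v\<in>?P. e v)"
      by (simp add: V ancestral_sum.simps sum.reindex)
    also have "\<dots> = (\<Sum>v\<in>?P \<inter> G. e v)"
      by (intro sum.mono_neutral_right) (auto intro: outside)
    also have "\<dots> \<le> (\<Sum>v\<in>G. e v)"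
      using G by (intro sum_mono2) auto
    also have "\<dots> \<le> B"
      unfolding B_def by (intro sum_mono e_le)
    finally show ?thesis .
  qed simp
  have "B < \<infinity>"
    unfolding B_def using G excursion_finite by simp
  then have "ancestral_sum e (V []) \<le> (\<integral>\<^sup>+w. ennreal_of_enat (hitting_time Anc w) \<partial>walk_law \<beta> T)"
    unfolding walk_law_def
    by (intro le_expectation_hitting_time[where B = B] walk_kernel_Anc assms sub bound) auto
  then show ?thesis
    by (simp add: ancestral_sum.simps e_def tree_labels_def)
qed

text \<open>
  The supremum of the iterates is the least fixed point of the recursion. As a fixed point it
  bounds the hitting time from above, and each iterate bounds it from below.
\<close>
theorem quenched_expected_hitting_time:
  assumes "0 \<le> \<beta>"
  shows "(\<integral>\<^sup>+w. ennreal_of_enat (hitting_time Anc w) \<partial>walk_law \<beta> T) = (SUP k. excursion \<beta> T k [])"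
proof (rule antisym)
  define e where "e u = (SUP k. excursion \<beta> T k u)" for u
  have "1 + (\<integral>\<^sup>+z. ancestral_sum e z \<partial>walk_kernel \<beta> T y) \<le> ancestral_sum e y" if "y \<noteq> Anc" for y
  proof -
    from that obtain u where y: "y = V u" by (cases y) auto
    show ?thesis
      unfolding y e_def by (intro eq_refl first_step_equation SUP_excursion assms)
  qed
  then have "(\<integral>\<^sup>+w. ennreal_of_enat (hitting_time Anc w) \<partial>walk_law \<beta> T) \<le> ancestral_sum e (V [])"
    unfolding walk_law_def by (intro expectation_hitting_time_le walk_kernel_Anc assms)
  then show "(\<integral>\<^sup>+w. ennreal_of_enat (hitting_time Anc w) \<partial>walk_law \<beta> T) \<le> (SUP k. excursion \<beta> T k [])"
    by (simp add: ancestral_sum.simps e_def)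
qed (intro SUP_least excursion_le_expected_hitting_time assms)

section \<open>Averaging over the tree\<close>

definition count_law :: "nat pmf \<Rightarrow> nat list \<Rightarrow> nat pmf" where
  "count_law p u = (if u = [] then map_pmf (\<lambda>k. k - 1) (size_biased p) else p)"

lemma tree_law_eq: "tree_law p = (\<Pi>\<^sub>M u\<in>UNIV. measure_pmf (count_law p u))"
  by (simp add: tree_law_def count_law_def)

lemma measurable_count [measurable]: "(\<lambda>T. T u) \<in> tree_law p \<rightarrow>\<^sub>M count_space UNIV"
proof -
  have "(\<lambda>T. T u) \<in> tree_law p \<rightarrow>\<^sub>M measure_pmf (count_law p u)"
    unfolding tree_law_eq by (rule measurable_component_singleton) simp
  then show ?thesis by simp
qed

lemma measurable_excursion [measurable]: "(\<lambda>T. excursion \<beta> T k u) \<in> borel_measurable (tree_law p)"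
proof (induction k arbitrary: u)
  case (Suc k)
  have "(\<lambda>T. \<Sum>i<T u. 1 + excursion \<beta> T k (u @ [i])) \<in> borel_measurable (tree_law p)"
    by (rule measurable_compose_countable[where f = "\<lambda>d T. \<Sum>i<d. 1 + excursion \<beta> T k (u @ [i])"])
       (use Suc.IH in \<open>auto intro!: borel_measurable_sum\<close>)
  then show ?case
    by simp
qed simp

text \<open>
  Replacing one coordinate of a product measure by an independent copy does not change the law.
  This is the form in which the independence of \<open>T u\<close> from all other offspring counts is used:
  the inner integral treats \<open>T u\<close> as the constant \<open>d\<close>.
\<close>
lemma nn_integral_tree_law_resample:
  assumes [measurable]: "F \<in> borel_measurable (tree_law p)"
  shows "(\<integral>\<^sup>+T. F T \<partial>tree_law p) = (\<integral>\<^sup>+d. (\<integral>\<^sup>+T. F (T(u := d)) \<partial>tree_law p) \<partial>count_law p u)"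
proof -
  interpret tree: prob_space "tree_law p" by (rule prob_space_tree_law)
  let ?N = "measure_pmf (count_law p u)"
  let ?f = "\<lambda>(d, T). T(u := d)"
  have law: "distr (?N \<Otimes>\<^sub>M tree_law p) (tree_law p) ?f = tree_law p"
    using distr_pair_PiM_eq_PiM[of UNIV "\<lambda>u. measure_pmf (count_law p u)" u]
    by (simp add: tree_law_eq prob_space_measure_pmf)
  have f [measurable]: "?f \<in> ?N \<Otimes>\<^sub>M tree_law p \<rightarrow>\<^sub>M tree_law p"
    unfolding tree_law_eq by (auto simp: case_prod_unfold intro!: measurable_fun_upd[where J = UNIV])
  have "(\<integral>\<^sup>+T. F T \<partial>tree_law p) = (\<integral>\<^sup>+x. F (?f x) \<partial>(?N \<Otimes>\<^sub>M tree_law p))"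
    by (subst law[symmetric]) (rule nn_integral_distr[OF f], simp add: law)
  also have "\<dots> = (\<integral>\<^sup>+d. (\<integral>\<^sup>+T. F (?f (d, T)) \<partial>tree_law p) \<partial>?N)"
    by (rule tree.nn_integral_fst[symmetric]) measurable
  finally show ?thesis by simp
qed

lemma excursion_fun_upd:
  "length u < length v \<Longrightarrow> excursion \<beta> (T(u := d)) k v = excursion \<beta> T k v"
  by (induction k arbitrary: v) auto

text \<open>
  Resample the offspring count at \<open>u\<close>. The iterates at the children of \<open>u\<close> do not see it, so each
  of the \<open>d\<close> children contributes the same mean, whatever \<open>d\<close> is.
\<close>
lemma expected_excursion_Suc:
  assumes children: "\<And>i. (\<integral>\<^sup>+T. excursion \<beta> T k (u @ [i]) \<partial>tree_law p) = m"
  shows "(\<integral>\<^sup>+T. excursion \<beta> T (Suc k) u \<partial>tree_law p) =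
    1 + ennreal (\<beta> / parent_weight \<beta> u) * (\<integral>\<^sup>+d. of_nat d \<partial>count_law p u) * (1 + m)"
proof -
  interpret tree: prob_space "tree_law p" by (rule prob_space_tree_law)
  let ?b = "ennreal (\<beta> / parent_weight \<beta> u)"
  have "(\<integral>\<^sup>+T. excursion \<beta> T (Suc k) u \<partial>tree_law p) =
      (\<integral>\<^sup>+d. (\<integral>\<^sup>+T. excursion \<beta> (T(u := d)) (Suc k) u \<partial>tree_law p) \<partial>count_law p u)"
    by (rule nn_integral_tree_law_resample) measurable
  also have "\<dots> = (\<integral>\<^sup>+d. (\<integral>\<^sup>+T. 1 + ?b * (\<Sum>i<d. 1 + excursion \<beta> T k (u @ [i])) \<partial>tree_law p) \<partial>count_law p u)"
    by (simp add: excursion_fun_upd)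
  also have "\<dots> = (\<integral>\<^sup>+d. 1 + ?b * (of_nat d * (1 + m)) \<partial>count_law p u)"
    by (simp add: nn_integral_add nn_integral_cmult nn_integral_sum children tree.emeasure_space_1)
  also have "\<dots> = 1 + ?b * (\<integral>\<^sup>+d. of_nat d \<partial>count_law p u) * (1 + m)"
    by (simp add: nn_integral_add nn_integral_cmult nn_integral_multc measure_pmf.emeasure_space_1 mult.assoc)
  finally show ?thesis .
qed

section \<open>The scalar recursion\<close>

primrec affine_iterate :: "ennreal \<Rightarrow> nat \<Rightarrow> ennreal" where
  "affine_iterate r 0 = 0"
| "affine_iterate r (Suc k) = 1 + r * (1 + affine_iterate r k)"

lemma incseq_affine_iterate: "incseq (affine_iterate r)"
proof (rule incseq_SucI)
  show "affine_iterate r k \<le> affine_iterate r (Suc k)" for k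
    by (induction k) (auto intro!: add_left_mono mult_left_mono)
qed

lemma affine_step_ennreal:
  assumes "0 \<le> r" "0 \<le> x"
  shows "1 + ennreal r * (1 + ennreal x) = ennreal (1 + r * (1 + x))"
  using assms by (simp add: ennreal_mult)

text \<open>
  For \<open>r < 1\<close> the supremum is a fixed point of \<open>m \<mapsto> 1 + r * (1 + m)\<close>; so is \<open>\<infinity>\<close>, which is excluded
  because the finite fixed point \<open>(1 + r) / (1 - r)\<close> bounds all iterates. For \<open>r \<ge> 1\<close> the iterates
  grow by at least 1 in each step.
\<close>
lemma one_plus_SUP_affine_iterate:
  assumes "0 \<le> r"
  shows "1 + (SUP k. affine_iterate (ennreal r) k) = (if r < 1 then ennreal (2 / (1 - r)) else \<infinity>)"
proof (cases "r < 1")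
  case True
  let ?m = "SUP k. affine_iterate (ennreal r) k"
  have fixpoint: "?m = 1 + ennreal r * (1 + ?m)"
  proof -
    have "?m = (SUP k. affine_iterate (ennreal r) (Suc k))"
      by (rule SUP_Suc_ennreal[symmetric, OF incseq_affine_iterate])
    also have "\<dots> = 1 + ennreal r * (1 + ?m)"
      by (simp add: ennreal_SUP_add_right SUP_mult_left_ennreal)
    finally show ?thesis .
  qed
  have "affine_iterate (ennreal r) k \<le> ennreal ((1 + r) / (1 - r))" for k
  proof (induction k)
    case (Suc k)
    have "affine_iterate (ennreal r) (Suc k) \<le> 1 + ennreal r * (1 + ennreal ((1 + r) / (1 - r)))"
      using Suc.IH by (auto intro!: add_left_mono mult_left_mono)
    also have "\<dots> = ennreal (1 + r * (1 + (1 + r) / (1 - r)))"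
      using assms True by (intro affine_step_ennreal) auto
    also have "1 + r * (1 + (1 + r) / (1 - r)) = (1 + r) / (1 - r)"
      using True by (simp add: field_simps)
    finally show ?case .
  qed simp
  then have "?m \<le> ennreal ((1 + r) / (1 - r))"
    by (rule SUP_least)
  then obtain x where x: "?m = ennreal x" "0 \<le> x"
    by (cases ?m) (auto simp: top_unique)
  have "ennreal x = ennreal (1 + r * (1 + x))"
    using fixpoint affine_step_ennreal[OF assms x(2)] x(1) by simp
  then have "x = 1 + r * (1 + x)"
    using assms x by (subst (asm) ennreal_inj) auto
  then have "1 + x = 2 / (1 - r)"
    using True by (simp add: field_simps)
  then show ?thesis
    using True x ennreal_plus[of 1 x] by simp
next
  case False
  have "of_nat k \<le> affine_iterate (ennreal r) k" for k
  proof (induction k)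
    case (Suc k)
    have "1 * (1 + of_nat k) \<le> ennreal r * (1 + affine_iterate (ennreal r) k)"
      using False Suc.IH by (intro mult_mono add_left_mono) auto
    then show ?case
      by (simp add: add_increasing)
  qed simp
  then have "(SUP k. of_nat k :: ennreal) \<le> (SUP k. affine_iterate (ennreal r) k)"
    by (intro SUP_mono) auto
  then show ?thesis
    using False by (simp add: ennreal_SUP_of_nat_eq_top top_unique)
qed

section \<open>The annealed expectation\<close>

lemma nn_integral_offspring:
  assumes "0 < offspring_mean p"
  shows "(\<integral>\<^sup>+k. of_nat k \<partial>p) = ennreal (offspring_mean p)"
  using integrable_offspring[OF assms]
  by (simp add: ennreal_of_nat_eq_real_of_nat nn_integral_eq_integral offspring_mean_def)

lemma expected_excursion_nonroot:
  assumes "0 < offspring_mean p" "0 \<le> \<beta>" "u \<noteq> []"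
  shows "(\<integral>\<^sup>+T. excursion \<beta> T k u \<partial>tree_law p) = affine_iterate (ennreal (\<beta> * offspring_mean p)) k"
  using assms(3)
proof (induction k arbitrary: u)
  case (Suc k)
  have "(\<integral>\<^sup>+T. excursion \<beta> T (Suc k) u \<partial>tree_law p) =
      1 + ennreal (\<beta> / parent_weight \<beta> u) * (\<integral>\<^sup>+d. of_nat d \<partial>count_law p u) *
        (1 + affine_iterate (ennreal (\<beta> * offspring_mean p)) k)"
    by (intro expected_excursion_Suc Suc.IH) simp
  then show ?case
    using assms Suc.prems
    by (simp add: parent_weight_def count_law_def nn_integral_offspring ennreal_mult del: excursion.simps)
qed simp

text \<open>
  The recursion is applied once more at \<open>\<rho>\<close>, where the offspring law and the weight of the parent
  differ from those at the other vertices.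
\<close>
theorem annealed_expectation_hitting_time:
  assumes "0 < offspring_mean p" "0 \<le> \<beta>"
  shows "annealed_expectation p \<beta> (\<lambda>W. ennreal_of_enat (hitting_time Anc W)) =
    1 + ennreal (\<beta> / (\<beta> + 1)) * (\<integral>\<^sup>+k. of_nat (k - 1) \<partial>size_biased p) *
      (if \<beta> * offspring_mean p < 1 then ennreal (2 / (1 - \<beta> * offspring_mean p)) else \<infinity>)"
proof -
  let ?r = "ennreal (\<beta> * offspring_mean p)"
  let ?D = "\<integral>\<^sup>+k. of_nat (k - 1) \<partial>size_biased p"
  have "annealed_expectation p \<beta> (\<lambda>W. ennreal_of_enat (hitting_time Anc W)) =
      (\<integral>\<^sup>+T. (SUP k. excursion \<beta> T k []) \<partial>tree_law p)"
    using assms by (simp add: annealed_expectation_def quenched_expected_hitting_time)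
  also have "\<dots> = (SUP k. \<integral>\<^sup>+T. excursion \<beta> T k [] \<partial>tree_law p)"
    using incseq_excursion
    by (intro nn_integral_monotone_convergence_SUP) (auto simp: incseq_def le_fun_def)
  also have "\<dots> = (SUP k. \<integral>\<^sup>+T. excursion \<beta> T (Suc k) [] \<partial>tree_law p)"
    by (intro SUP_Suc_ennreal[symmetric] incseq_SucI nn_integral_mono excursion_mono_Suc)
  also have "\<dots> = (SUP k. 1 + ennreal (\<beta> / (\<beta> + 1)) * ?D * (1 + affine_iterate ?r k))"
  proof (intro SUP_cong refl)
    fix k
    have "(\<integral>\<^sup>+T. excursion \<beta> T (Suc k) [] \<partial>tree_law p) =
        1 + ennreal (\<beta> / parent_weight \<beta> []) * (\<integral>\<^sup>+d. of_nat d \<partial>count_law p []) * (1 + affine_iterate ?r k)"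
      by (intro expected_excursion_Suc expected_excursion_nonroot assms) simp
    then show "(\<integral>\<^sup>+T. excursion \<beta> T (Suc k) [] \<partial>tree_law p) =
        1 + ennreal (\<beta> / (\<beta> + 1)) * ?D * (1 + affine_iterate ?r k)"
      by (simp add: parent_weight_def count_law_def del: excursion.simps)
  qed
  also have "\<dots> = 1 + ennreal (\<beta> / (\<beta> + 1)) * ?D * (1 + (SUP k. affine_iterate ?r k))"
    by (simp add: ennreal_SUP_add_right SUP_mult_left_ennreal)
  also have "1 + (SUP k. affine_iterate ?r k) =
      (if \<beta> * offspring_mean p < 1 then ennreal (2 / (1 - \<beta> * offspring_mean p)) else \<infinity>)"
    using assms by (intro one_plus_SUP_affine_iterate) simp
  finally show ?thesis .
qed

section \<open>The mean offspring number of the root\<close>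

lemma nn_integral_size_biased:
  assumes "0 < offspring_mean p"
  shows "(\<integral>\<^sup>+k. of_nat (k - 1) \<partial>size_biased p) =
    (\<integral>\<^sup>+k. ennreal (real k * (real k - 1) / offspring_mean p) \<partial>p)"
proof -
  have "ennreal (real k * pmf p k / offspring_mean p) * of_nat (k - 1) =
      ennreal (pmf p k) * ennreal (real k * (real k - 1) / offspring_mean p)" for k
    using assms by (cases k) (auto simp: ennreal_of_nat_eq_real_of_nat ac_simps simp flip: ennreal_mult)
  then show ?thesis
    by (simp add: nn_integral_measure_pmf pmf_size_biased[OF assms])
qed

lemma expected_root_children_pos:
  assumes "0 < offspring_mean p" "k \<ge> 2" "0 < pmf p k"
  shows "0 < (\<integral>\<^sup>+k. of_nat (k - 1) \<partial>size_biased p)"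
proof -
  have "k \<in> set_pmf (size_biased p)"
    using assms by (simp add: set_pmf_iff pmf_size_biased)
  moreover have "of_nat (k - 1) \<noteq> (0 :: ennreal)"
    using assms(2) by simp
  ultimately show ?thesis
    by (auto simp: zero_less_iff_neq_zero nn_integral_0_iff_AE AE_measure_pmf_iff)
qed

text \<open>
  As \<open>(k - \<mu>)\<^sup>2 \<le> k * (k - 1) + k + \<mu>\<^sup>2\<close>, the second factorial moment dominates the variance up to
  finite terms.
\<close>
lemma expected_root_children_infinite:
  assumes "0 < offspring_mean p" "offspring_variance p = \<infinity>"
  shows "(\<integral>\<^sup>+k. of_nat (k - 1) \<partial>size_biased p) = \<infinity>"
proof -
  define \<mu> where "\<mu> = offspring_mean p"
  have \<mu>: "0 < \<mu>" using assms by (simp add: \<mu>_def)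
  let ?D = "\<integral>\<^sup>+k. of_nat (k - 1) \<partial>size_biased p"
  have bound: "ennreal ((real k - \<mu>)\<^sup>2) \<le>
      ennreal \<mu> * ennreal (real k * (real k - 1) / \<mu>) + (of_nat k + ennreal (\<mu>\<^sup>2))" for k
  proof -
    have nonneg: "0 \<le> real k * (real k - 1)" by (cases k) auto
    have "(real k - \<mu>)\<^sup>2 \<le> real k * (real k - 1) + (real k + \<mu>\<^sup>2)"
      using \<mu> by (simp add: power2_eq_square algebra_simps)
    then have "ennreal ((real k - \<mu>)\<^sup>2) \<le> ennreal (real k * (real k - 1) + (real k + \<mu>\<^sup>2))"
      by (rule ennreal_leI)
    also have "\<dots> = ennreal (real k * (real k - 1)) + (of_nat k + ennreal (\<mu>\<^sup>2))"
      using nonneg by (simp add: ennreal_of_nat_eq_real_of_nat)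
    also have "ennreal (real k * (real k - 1)) = ennreal \<mu> * ennreal (real k * (real k - 1) / \<mu>)"
      using \<mu> nonneg by (simp flip: ennreal_mult)
    finally show ?thesis .
  qed
  have "\<infinity> = (\<integral>\<^sup>+k. ennreal ((real k - \<mu>)\<^sup>2) \<partial>p)"
    using assms(2) by (simp add: offspring_variance_def \<mu>_def)
  also have "\<dots> \<le> (\<integral>\<^sup>+k. ennreal \<mu> * ennreal (real k * (real k - 1) / \<mu>) + (of_nat k + ennreal (\<mu>\<^sup>2)) \<partial>p)"
    by (intro nn_integral_mono bound)
  also have "\<dots> = ennreal \<mu> * ?D + (ennreal \<mu> + ennreal (\<mu>\<^sup>2))"
    unfolding nn_integral_size_biased[OF assms(1)] using assms(1)
    by (simp add: nn_integral_add nn_integral_cmult nn_integral_offspring \<mu>_def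
        measure_pmf.emeasure_space_1)
  finally show ?thesis
    by (auto simp: top_unique ennreal_mult_eq_top_iff)
qed

text \<open>
  Integrate \<open>k * (k - 1) = (k - \<mu>)\<^sup>2 + (2 * \<mu> - 1) * k - \<mu>\<^sup>2\<close>. The inequality, which is
  nonnegativity of the mean just computed, makes the formula unaffected by the truncation of
  negative reals in \<open>ennreal\<close>.
\<close>
lemma expected_root_children_finite:
  assumes mean: "0 < offspring_mean p" and var: "offspring_variance p < \<infinity>"
  defines "\<mu> \<equiv> offspring_mean p"
  shows "(\<integral>\<^sup>+k. of_nat (k - 1) \<partial>size_biased p) =
      ennreal ((enn2real (offspring_variance p) - \<mu> * (1 - \<mu>)) / \<mu>)"
    and "\<mu> * (1 - \<mu>) \<le> enn2real (offspring_variance p)"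
proof -
  let ?v = "\<lambda>k. (real k - \<mu>)\<^sup>2"
  have \<mu>: "0 < \<mu>" using mean by (simp add: \<mu>_def)
  have int: "integrable (measure_pmf p) real"
    by (rule integrable_offspring[OF mean])
  have int_v: "integrable (measure_pmf p) ?v"
    using var by (intro integrableI_nonneg) (auto simp: offspring_variance_def \<mu>_def)
  have expand: "real k * (real k - 1) / \<mu> = (?v k + (2 * \<mu> - 1) * real k - \<mu>\<^sup>2) / \<mu>" for k
    by (simp add: power2_eq_square algebra_simps)
  have nonneg: "0 \<le> real k * (real k - 1) / \<mu>" for k
    using \<mu> by (cases k) auto
  have var_eq: "measure_pmf.expectation p ?v = enn2real (offspring_variance p)"
    by (simp add: integral_eq_nn_integral offspring_variance_def \<mu>_def)
  have "(\<integral>\<^sup>+k. ennreal (real k * (real k - 1) / \<mu>) \<partial>p) =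
      ennreal (measure_pmf.expectation p (\<lambda>k. real k * (real k - 1) / \<mu>))"
    using int int_v nonneg unfolding expand by (intro nn_integral_eq_integral) auto
  also have E: "measure_pmf.expectation p (\<lambda>k. real k * (real k - 1) / \<mu>) =
      (enn2real (offspring_variance p) - \<mu> * (1 - \<mu>)) / \<mu>"
  proof -
    have "measure_pmf.expectation p (\<lambda>k. real k * (real k - 1) / \<mu>) =
        (measure_pmf.expectation p ?v + (2 * \<mu> - 1) * measure_pmf.expectation p real - \<mu>\<^sup>2) / \<mu>"
      unfolding expand using int int_v by simp
    also have "measure_pmf.expectation p real = \<mu>"
      by (simp add: \<mu>_def offspring_mean_def)
    also have "measure_pmf.expectation p ?v + (2 * \<mu> - 1) * \<mu> - \<mu>\<^sup>2 =
        enn2real (offspring_variance p) - \<mu> * (1 - \<mu>)"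
      unfolding var_eq by (simp add: power2_eq_square algebra_simps)
    finally show ?thesis .
  qed
  finally show "(\<integral>\<^sup>+k. of_nat (k - 1) \<partial>size_biased p) =
      ennreal ((enn2real (offspring_variance p) - \<mu> * (1 - \<mu>)) / \<mu>)"
    unfolding nn_integral_size_biased[OF mean] \<mu>_def .
  have "0 \<le> measure_pmf.expectation p (\<lambda>k. real k * (real k - 1) / \<mu>)"
    by (intro Bochner_Integration.integral_nonneg nonneg)
  then show "\<mu> * (1 - \<mu>) \<le> enn2real (offspring_variance p)"
    unfolding E using \<mu> by (simp add: zero_le_divide_iff)
qed

section \<open>The expected hitting time\<close>

theorem lemma4p4:
  fixes p :: "nat pmf" and \<beta> \<mu> :: real and \<sigma>2 :: ennreal
  assumes mean: "\<mu> = offspring_mean p" "0 < \<mu>" "\<mu> < 1"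
    and variance: "\<sigma>2 = offspring_variance p"
    and nontrivial: "\<exists>k\<ge>2. 0 < pmf p k"
    and bias: "1 \<le> \<beta>"
  shows "(\<beta> * \<mu> < 1 \<and> \<sigma>2 < \<infinity> \<longrightarrow>
            annealed_expectation p \<beta> (\<lambda>W. ennreal_of_enat (hitting_time Anc W)) =
            ennreal ((\<mu> * (\<beta> + 1) * (1 - \<beta> * \<mu>) + 2 * \<beta> * (enn2real \<sigma>2 - \<mu> * (1 - \<mu>)))
                     / (\<mu> * (\<beta> + 1) * (1 - \<beta> * \<mu>)))) \<and>
         (\<sigma>2 = \<infinity> \<or> \<beta> \<ge> inverse \<mu> \<longrightarrow>
            annealed_expectation p \<beta> (\<lambda>W. ennreal_of_enat (hitting_time Anc W)) = \<infinity>)"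
proof (intro conjI impI)
  let ?E = "annealed_expectation p \<beta> (\<lambda>W. ennreal_of_enat (hitting_time Anc W))"
  let ?D = "\<integral>\<^sup>+k. of_nat (k - 1) \<partial>size_biased p"
  have E: "?E = 1 + ennreal (\<beta> / (\<beta> + 1)) * ?D *
      (if \<beta> * \<mu> < 1 then ennreal (2 / (1 - \<beta> * \<mu>)) else \<infinity>)"
    using annealed_expectation_hitting_time[of p \<beta>] mean bias by simp
  have \<beta>: "0 < \<beta> / (\<beta> + 1)" using bias by simp
  show "?E = \<infinity>" if "\<sigma>2 = \<infinity> \<or> \<beta> \<ge> inverse \<mu>"
  proof -
    have D: "?D \<noteq> 0"
      using expected_root_children_pos nontrivial mean by fastforce
    have "\<sigma>2 = \<infinity> \<or> \<not> \<beta> * \<mu> < 1"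
      using that mean by (auto simp: field_simps)
    then show ?thesis
      using D \<beta> expected_root_children_infinite[of p] mean variance
      unfolding E by (auto simp: ennreal_mult_eq_top_iff)
  qed
  show "?E = ennreal ((\<mu> * (\<beta> + 1) * (1 - \<beta> * \<mu>) + 2 * \<beta> * (enn2real \<sigma>2 - \<mu> * (1 - \<mu>)))
      / (\<mu> * (\<beta> + 1) * (1 - \<beta> * \<mu>)))" if "\<beta> * \<mu> < 1 \<and> \<sigma>2 < \<infinity>"
  proof -
    define a where "a = enn2real \<sigma>2 - \<mu> * (1 - \<mu>)"
    have D: "?D = ennreal (a / \<mu>)" and a: "0 \<le> a"
      using expected_root_children_finite[of p] that mean variance by (auto simp: a_def)
    have "?E = ennreal (1 + \<beta> / (\<beta> + 1) * (a / \<mu>) * (2 / (1 - \<beta> * \<mu>)))"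
    proof -
      have combine: "1 + ennreal x * ennreal y * ennreal z = ennreal (1 + x * y * z)"
        if "0 \<le> x" "0 \<le> y" "0 \<le> z" for x y z :: real
        using that by (simp add: ennreal_mult)
      have "0 \<le> a / \<mu>" "0 \<le> 2 / (1 - \<beta> * \<mu>)"
        using that a mean(2) by auto
      from combine[OF less_imp_le[OF \<beta>] this] show ?thesis
        unfolding E D using that by (simp only: if_True)
    qed
    also have "1 + \<beta> / (\<beta> + 1) * (a / \<mu>) * (2 / (1 - \<beta> * \<mu>)) =
        (\<mu> * (\<beta> + 1) * (1 - \<beta> * \<mu>) + 2 * \<beta> * a) / (\<mu> * (\<beta> + 1) * (1 - \<beta> * \<mu>))"
    proof -
      have "\<mu> \<noteq> 0" "\<beta> + 1 \<noteq> 0" "1 - \<beta> * \<mu> \<noteq> 0"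
        using that mean bias by auto
      then show ?thesis by (simp add: add_divide_distrib mult_ac)
    qed
    finally show ?thesis by (simp add: a_def)
  qed
qed

end
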